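(* Let $0<p<\infty$ and let $n$ be a positive integer. Let $f:D\to\mathbb{B}$ have the representation $$f=\sum_{k=0}^{n-1}\widehat{z^*}^{\,k}\,\varphi_k,\qquad \varphi_k\in Hol(D,\mathbb{B}).$$ Then $f\in P^{n,p}(D,\mathbb{B})$ if and only if $\varphi_k\in H^p(D,\mathbb{B})$ for each $k$.
   Context: $D$ is the open unit disk in $\mathbb{C}$. For $u=x+iy\in\mathbb{C}$, $u^*=x-iy$. $\mathbb{B}$ denotes the bicomplex numbers: the commutative $\mathbb{C}$-algebra of elements $z_1+jz_2$ with $z_1,z_2\in\mathbb{C}$, $j^2=-1$, $ij=ji$. Put $p^\pm=\frac12(1\pm ij)$. Each $w=z_1+jz_2\in\mathbb{B}$ is uniquely $w=p^+w^++p^-w^-$ with $w^\pm=z_1\mp iz_2\in\mathbb{C}$, and $\|w\|_{\mathbb{B}}=\sqrt{(|w^+|^2+|w^-|^2)/2}$. The bicomplexification of $u=x+iy\in\mathbb{C}$ is $\widehat{u}=x+jy\in\mathbb{B}$; thus $\widehat{z^*}=x-jy$ for $z=x+iy$. $\bar\partial=\frac12(\partial_x+j\partial_y)$. $Hol(D,\mathbb{B})$ is the set of $f:D\to\mathbb{B}$ with $\bar\partial f=0$. For $0<p<\infty$, $\|f\|_{H^p_{\mathbb{B}}}=\sup_{0<r<1}\left(\int_0^{2\pi}\|f(re^{i\theta})\|_{\mathbb{B}}^p\,d\theta\right)^{1/p}$, and $H^p(D,\mathbb{B})$ is the set of $f\in Hol(D,\mathbb{B})$ with $\|f\|_{H^p_{\mathbb{B}}}<\infty$.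 $P^n(D,\mathbb{B})$ is the set of $f:D\to\mathbb{B}$ with $\bar\partial^{\,n}f=0$, and $P^{n,p}(D,\mathbb{B})$ is the set of $f\in P^n(D,\mathbb{B})$ with $\sum_{k=0}^{n-1}\|\bar\partial^{\,k}f\|_{H^p_{\mathbb{B}}}<\infty$. *)

theory Defs
  imports "HOL-Analysis.Analysis"
begin

section \<open>Bicomplex numbers\<close>

text \<open>\<open>Bicomplex z1 z2\<close> stands for $z_1 + j z_2$.\<close>

codatatype bicomplex = Bicomplex (bcfst: complex) (bcsnd: complex)

lemma bicomplex_eqI [intro?]: "bcfst v = bcfst w \<Longrightarrow> bcsnd v = bcsnd w \<Longrightarrow> v = w"
  by (rule bicomplex.expand) simp

lemma bicomplex_eq_iff: "v = w \<longleftrightarrow> bcfst v = bcfst w \<and> bcsnd v = bcsnd w"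
  by (auto intro: bicomplex.expand)

instantiation bicomplex :: ab_group_add
begin

primcorec zero_bicomplex where
  "bcfst 0 = 0"
| "bcsnd 0 = 0"

primcorec plus_bicomplex where
  "bcfst (v + w) = bcfst v + bcfst w"
| "bcsnd (v + w) = bcsnd v + bcsnd w"

primcorec uminus_bicomplex where
  "bcfst (- w) = - bcfst w"
| "bcsnd (- w) = - bcsnd w"

primcorec minus_bicomplex where
  "bcfst (v - w) = bcfst v - bcfst w"
| "bcsnd (v - w) = bcsnd v - bcsnd w"

instance
  by standard (simp_all add: bicomplex_eq_iff)

end

instantiation bicomplex :: comm_ring_1
begin

primcorec one_bicomplex where
  "bcfst 1 = 1"
| "bcsnd 1 = 0"

primcorec times_bicomplex where
  "bcfst (v * w) = bcfst v * bcfst w - bcsnd v * bcsnd w"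
| "bcsnd (v * w) = bcfst v * bcsnd w + bcsnd v * bcfst w"

instance
  by standard (simp_all add: bicomplex_eq_iff algebra_simps)

end

instantiation bicomplex :: real_algebra_1
begin

primcorec scaleR_bicomplex where
  "bcfst (scaleR r w) = scaleR r (bcfst w)"
| "bcsnd (scaleR r w) = scaleR r (bcsnd w)"

instance
  by standard (simp_all add: bicomplex_eq_iff algebra_simps)

end

definition bc_of_complex :: "complex \<Rightarrow> bicomplex" where
  "bc_of_complex z = Bicomplex z 0"

definition bc_j :: bicomplex where
  "bc_j = Bicomplex 0 1"

definition bc_pplus :: bicomplex where
  "bc_pplus = (1/2) *\<^sub>R (1 + bc_of_complex \<i> * bc_j)"

definition bc_pminus :: bicomplex where
  "bc_pminus = (1/2) *\<^sub>R (1 - bc_of_complex \<i> * bc_j)"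

definition bc_plus :: "bicomplex \<Rightarrow> complex" where
  "bc_plus w = bcfst w - \<i> * bcsnd w"

definition bc_minus :: "bicomplex \<Rightarrow> complex" where
  "bc_minus w = bcfst w + \<i> * bcsnd w"

lemma bicomplex_decomp: "w = bc_of_complex (bcfst w) + bc_j * bc_of_complex (bcsnd w)"
  by (simp add: bicomplex_eq_iff bc_of_complex_def bc_j_def)

lemma bicomplex_idempotent_decomp:
  "w = bc_pplus * bc_of_complex a + bc_pminus * bc_of_complex b
    \<longleftrightarrow> a = bc_plus w \<and> b = bc_minus w"
proof -
  let ?v = "bc_pplus * bc_of_complex a + bc_pminus * bc_of_complex b"
  have "bcfst ?v = (a + b) / 2" "bcsnd ?v = \<i> * (a - b) / 2"
    by (simp_all add: bc_pplus_def bc_pminus_def bc_of_complex_def bc_j_def complex_eq_iff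
        add_divide_distrib diff_divide_distrib)
  then show ?thesis
    unfolding bicomplex_eq_iff[of w] bc_plus_def bc_minus_def
    by (auto simp: complex_eq_iff field_simps)
qed

text \<open>
  The norm is not submultiplicative (\<open>norm bc_pplus = 1 / sqrt 2\<close> although
  \<open>bc_pplus\<close> is idempotent), so there is no \<open>real_normed_algebra\<close> instance.
\<close>

instantiation bicomplex :: real_normed_vector
begin

definition norm_bicomplex :: "bicomplex \<Rightarrow> real" where
  "norm w = sqrt (((cmod (bc_plus w))\<^sup>2 + (cmod (bc_minus w))\<^sup>2) / 2)"

definition sgn_bicomplex_def: "sgn w = w /\<^sub>R norm w" for w :: bicomplex

definition dist_bicomplex_def: "dist v w = norm (v - w)" for v w :: bicomplex

definition uniformity_bicomplex_def [code del]:
  "(uniformity :: (bicomplex \<times> bicomplex) filter)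
    = (INF e\<in>{0 <..}. principal {(x, y). dist x y < e})"

definition open_bicomplex_def [code del]:
  "open (U :: bicomplex set)
    \<longleftrightarrow> (\<forall>x\<in>U. eventually (\<lambda>(x', y). x' = x \<longrightarrow> y \<in> U) uniformity)"

instance
proof
  fix r :: real and v w :: bicomplex
  have add: "bc_plus (v + w) = bc_plus v + bc_plus w" "bc_minus (v + w) = bc_minus v + bc_minus w"
    by (simp_all add: bc_plus_def bc_minus_def algebra_simps)
  have scale: "bc_plus (r *\<^sub>R v) = r *\<^sub>R bc_plus v" "bc_minus (r *\<^sub>R v) = r *\<^sub>R bc_minus v"
    by (simp_all add: bc_plus_def bc_minus_def algebra_simps)
  have zero: "bc_plus v = 0 \<and> bc_minus v = 0 \<longleftrightarrow> v = 0"
    by (auto simp: bc_plus_def bc_minus_def bicomplex_eq_iff complex_eq_iff)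
  have norm: "norm u = sqrt ((cmod (bc_plus u))\<^sup>2 + (cmod (bc_minus u))\<^sup>2) / sqrt 2"
    for u :: bicomplex
    by (simp add: norm_bicomplex_def real_sqrt_divide)
  show "(norm v = 0) = (v = 0)"
    using zero by (simp add: norm)
  have "sqrt ((cmod (bc_plus v + bc_plus w))\<^sup>2 + (cmod (bc_minus v + bc_minus w))\<^sup>2)
      \<le> sqrt ((cmod (bc_plus v) + cmod (bc_plus w))\<^sup>2 + (cmod (bc_minus v) + cmod (bc_minus w))\<^sup>2)"
    by (intro real_sqrt_le_mono add_mono power_mono norm_triangle_ineq) simp_all
  also have "\<dots> \<le> sqrt ((cmod (bc_plus v))\<^sup>2 + (cmod (bc_minus v))\<^sup>2)
      + sqrt ((cmod (bc_plus w))\<^sup>2 + (cmod (bc_minus w))\<^sup>2)"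
    by (rule real_sqrt_sum_squares_triangle_ineq)
  finally show "norm (v + w) \<le> norm v + norm w"
    by (simp add: norm add divide_right_mono flip: add_divide_distrib)
  show "norm (r *\<^sub>R v) = \<bar>r\<bar> * norm v"
    by (simp add: norm scale power_mult_distrib real_sqrt_mult flip: distrib_left)
qed (rule sgn_bicomplex_def dist_bicomplex_def open_bicomplex_def uniformity_bicomplex_def)+

end

text \<open>The bicomplexification $\widehat{x + iy} = x + jy$ of a complex number.\<close>

definition bc_hat :: "complex \<Rightarrow> bicomplex" where
  "bc_hat u = of_real (Re u) + bc_j * of_real (Im u)"


section \<open>Functions on the unit disk\<close>

text \<open>
  Functions on the disk are total functions on \<^typ>\<open>complex\<close>; everything below depends only on
  their values on the (open) disk.
\<close>

abbreviation unit_disk :: "complex set" where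
  "unit_disk \<equiv> ball 0 1"

definition partial_x :: "(complex \<Rightarrow> bicomplex) \<Rightarrow> complex \<Rightarrow> bicomplex" where
  "partial_x f z = vector_derivative (\<lambda>x. f (Complex x (Im z))) (at (Re z))"

definition partial_y :: "(complex \<Rightarrow> bicomplex) \<Rightarrow> complex \<Rightarrow> bicomplex" where
  "partial_y f z = vector_derivative (\<lambda>y. f (Complex (Re z) y)) (at (Im z))"

definition bc_dbar :: "(complex \<Rightarrow> bicomplex) \<Rightarrow> complex \<Rightarrow> bicomplex" where
  "bc_dbar f z = (1/2) *\<^sub>R (partial_x f z + bc_j * partial_y f z)"

text \<open>
  The equation $\bar\partial^n f = 0$ is understood classically: each of
  $f, \bar\partial f, \ldots, \bar\partial^{n-1} f$ is real (Frechet) differentiable on the disk,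
  so that the next application of $\bar\partial$ is meaningful.  By Goursat's theorem and induction on \<open>n\<close>, applied
  to idempotent components, such functions are automatically real analytic.
\<close>

definition bc_poly :: "nat \<Rightarrow> (complex \<Rightarrow> bicomplex) set" where
  "bc_poly n = {f. (\<forall>k<n. (bc_dbar ^^ k) f differentiable_on unit_disk)
                 \<and> (\<forall>z\<in>unit_disk. (bc_dbar ^^ n) f z = 0)}"

definition bc_hol :: "(complex \<Rightarrow> bicomplex) set" where
  "bc_hol = {f. f differentiable_on unit_disk \<and> (\<forall>z\<in>unit_disk. bc_dbar f z = 0)}"

text \<open>Real powers on $[0,\infty]$, used for positive exponents only.\<close>

definition ennreal_powr :: "ennreal \<Rightarrow> real \<Rightarrow> ennreal" where
  "ennreal_powr x a = (if x = \<infinity> then \<infinity> else ennreal (enn2real x powr a))"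

definition hardy_norm :: "real \<Rightarrow> (complex \<Rightarrow> bicomplex) \<Rightarrow> ennreal" where
  "hardy_norm p f =
    (SUP r\<in>{0<..<1}. ennreal_powr
      (\<integral>\<^sup>+\<theta>\<in>{0..2*pi}. ennreal (norm (f (of_real r * exp (\<i> * of_real \<theta>))) powr p) \<partial>lborel)
      (1 / p))"

definition bc_hardy :: "real \<Rightarrow> (complex \<Rightarrow> bicomplex) set" where
  "bc_hardy p = {f \<in> bc_hol. hardy_norm p f < \<infinity>}"

definition bc_poly_hardy :: "nat \<Rightarrow> real \<Rightarrow> (complex \<Rightarrow> bicomplex) set" where
  "bc_poly_hardy n p = {f \<in> bc_poly n. (\<Sum>k<n. hardy_norm p ((bc_dbar ^^ k) f)) < \<infinity>}"

end

theory Submission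
  imports Defs
begin

text \<open>
  Write $\zeta(z) = \widehat{z^*}$.  The operator $\bar\partial$ is a derivation with
  $\bar\partial\zeta = 1$, so it kills the holomorphic coefficients and acts on
  $\sum_{k \le n} \zeta^k \varphi_k$ as formal differentiation in $\zeta$: the result
  $\sum_{k<n} \zeta^k (k+1)\varphi_{k+1}$ has the same shape with one term less
  (\<open>bc_dbar_polyanalytic_sum\<close>).  On the other side, $f$ lies in $P^{n+1,p}$ exactly when $f$ is
  differentiable, has finite Hardy norm, and $\bar\partial f$ lies in $P^{n,p}$
  (\<open>bc_poly_hardy_Suc\<close>).  The theorem is therefore an induction on $n$: the induction hypothesis,
  applied to $\bar\partial f$, disposes of $\varphi_1, \ldots, \varphi_n$, and what is left is that,
  once these are in $H^p$, $f$ has finite Hardy norm if and only if $\varphi_0$ has.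

  For this last point the two functions differ by $\sum_{k \ge 1} \zeta^k \varphi_k$.  Both
  idempotent components of $\zeta(z)$ have modulus $|z|$, so multiplication by $\zeta(z)$
  multiplies the bicomplex norm by $|z| < 1$ (\<open>norm_bc_hat_mult\<close>), and the continuous functions of
  finite Hardy norm form a vector space, also when $p < 1$ (\<open>hardy_fin_add\<close>).
\<close>

section \<open>The bicomplex norm and multiplication\<close>

lemma bc_plus_mult: "bc_plus (v * w) = bc_plus v * bc_plus w"
  by (simp add: bc_plus_def algebra_simps)

lemma bc_minus_mult: "bc_minus (v * w) = bc_minus v * bc_minus w"
  by (simp add: bc_minus_def algebra_simps)

text \<open>
  The constant comes from estimating $|v^+w^+|^2 + |v^-w^-|^2$ by the product of the two sums of
  squares, each of which is twice the square of a norm.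
\<close>

lemma norm_bicomplex_mult_le: "norm (v * w) \<le> sqrt 2 * (norm v * norm w)" for v w :: bicomplex
proof -
  define a b c d where "a = cmod (bc_plus v)" and "b = cmod (bc_minus v)"
    and "c = cmod (bc_plus w)" and "d = cmod (bc_minus w)"
  have "(a * c)\<^sup>2 + (b * d)\<^sup>2 \<le> (a\<^sup>2 + b\<^sup>2) * (c\<^sup>2 + d\<^sup>2)"
    by (simp add: power_mult_distrib algebra_simps)
  then have "sqrt (((a * c)\<^sup>2 + (b * d)\<^sup>2) / 2)
      \<le> sqrt (2 * (((a\<^sup>2 + b\<^sup>2) / 2) * ((c\<^sup>2 + d\<^sup>2) / 2)))"
    by (intro real_sqrt_le_mono) simp
  then show ?thesis
    by (simp only: norm_bicomplex_def bc_plus_mult bc_minus_mult norm_mult real_sqrt_mult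
        a_def b_def c_def d_def)
qed

text \<open>
  This stands in for a normed algebra structure: it gives continuity of the product and the
  product rule for Frechet derivatives.
\<close>

lemma bounded_bilinear_bicomplex_mult:
  "bounded_bilinear (\<lambda>v w :: bicomplex. v * w)"
  by unfold_locales
    (auto simp: distrib_left distrib_right intro!: exI[of _ "sqrt 2"]
      order_trans[OF norm_bicomplex_mult_le])

lemma norm_bc_hat_mult: "norm (bc_hat u * w) = cmod u * norm w"
proof -
  have "bc_plus (bc_hat u) = cnj u" "bc_minus (bc_hat u) = u"
    by (simp_all add: bc_plus_def bc_minus_def bc_hat_def bc_j_def of_real_def complex_eq_iff)
  then have "norm (bc_hat u * w)
      = sqrt ((cmod u)\<^sup>2 * (((cmod (bc_plus w))\<^sup>2 + (cmod (bc_minus w))\<^sup>2) / 2))"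
    by (simp add: norm_bicomplex_def bc_plus_mult bc_minus_mult norm_mult power_mult_distrib
        distrib_left)
  then show ?thesis
    by (simp only: norm_bicomplex_def real_sqrt_mult) simp
qed

lemma norm_bc_hat_power_mult: "norm (bc_hat u ^ k * w) = cmod u ^ k * norm w"
  by (induction k) (simp_all add: mult.assoc norm_bc_hat_mult)

section \<open>The operator \<open>bc_dbar\<close> as a derivation\<close>

text \<open>
  The partial derivatives are the values of the Frechet derivative at $1$ and $i$; every rule for
  \<open>bc_dbar\<close> below is read off from the corresponding rule for Frechet derivatives.
\<close>

lemma has_derivative_imp_bc_dbar:
  assumes "(f has_derivative f') (at z)"
  shows "bc_dbar f z = (1/2) *\<^sub>R (f' 1 + bc_j * f' \<i>)"
proof -
  interpret f': bounded_linear f'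
    using assms by (rule has_derivative_bounded_linear)
  have f: "(f has_derivative f') (at (Complex (Re z) (Im z)))"
    using assms by simp
  have x: "((\<lambda>x. Complex x (Im z)) has_derivative (\<lambda>h. h *\<^sub>R 1)) (at (Re z))"
    unfolding Complex_eq
    by (auto intro!: derivative_eq_intros simp: scaleR_conv_of_real)
  have y: "((\<lambda>y. Complex (Re z) y) has_derivative (\<lambda>h. h *\<^sub>R \<i>)) (at (Im z))"
    unfolding Complex_eq
    by (auto intro!: derivative_eq_intros simp: scaleR_conv_of_real)
  have "((\<lambda>x. f (Complex x (Im z))) has_vector_derivative f' 1) (at (Re z))"
    using has_derivative_compose[OF x f] by (simp add: has_vector_derivative_def f'.scaleR)
  moreover have "((\<lambda>y. f (Complex (Re z) y)) has_vector_derivative f' \<i>) (at (Im z))"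
    using has_derivative_compose[OF y f] by (simp add: has_vector_derivative_def f'.scaleR)
  ultimately show ?thesis
    by (simp add: bc_dbar_def partial_x_def partial_y_def vector_derivative_at)
qed

lemma bc_dbar_cong_open:
  assumes "open S" "z \<in> S" "f differentiable at z" "\<And>w. w \<in> S \<Longrightarrow> f w = g w"
  shows "bc_dbar g z = bc_dbar f z"
proof -
  obtain f' where f': "(f has_derivative f') (at z)"
    using assms(3) by (auto simp: differentiable_def)
  then have "(g has_derivative f') (at z)"
    using assms(1,2,4) by (rule has_derivative_transform_within_open)
  with f' show ?thesis
    by (simp add: has_derivative_imp_bc_dbar)
qed

lemma
  assumes "f differentiable at z" "g differentiable at z"
  shows differentiable_bicomplex_mult: "(\<lambda>z. f z * g z :: bicomplex) differentiable at z"
    and bc_dbar_mult: "bc_dbar (\<lambda>z. f z * g z) z = bc_dbar f z * g z + f z * bc_dbar g z"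
proof -
  obtain f' g' where d: "(f has_derivative f') (at z)" "(g has_derivative g') (at z)"
    using assms by (auto simp: differentiable_def)
  note fg = bounded_bilinear.FDERIV[OF bounded_bilinear_bicomplex_mult d]
  then show "(\<lambda>z. f z * g z) differentiable at z"
    by (auto simp: differentiable_def)
  show "bc_dbar (\<lambda>z. f z * g z) z = bc_dbar f z * g z + f z * bc_dbar g z"
    by (simp add: has_derivative_imp_bc_dbar[OF fg] d[THEN has_derivative_imp_bc_dbar]
        algebra_simps)
qed

lemma bc_dbar_sum:
  assumes "\<And>k. k \<in> K \<Longrightarrow> f k differentiable at z"
  shows "bc_dbar (\<lambda>z. \<Sum>k\<in>K. f k z) z = (\<Sum>k\<in>K. bc_dbar (f k) z)"
proof -
  obtain f' where f': "\<And>k. k \<in> K \<Longrightarrow> (f k has_derivative f' k) (at z)"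
    using assms by (auto simp: differentiable_def) metis
  then have "((\<lambda>z. \<Sum>k\<in>K. f k z) has_derivative (\<lambda>h. \<Sum>k\<in>K. f' k h)) (at z)"
    by (rule has_derivative_sum)
  then have "bc_dbar (\<lambda>z. \<Sum>k\<in>K. f k z) z
      = (\<Sum>k\<in>K. (1/2) *\<^sub>R (f' k 1 + bc_j * f' k \<i>))"
    by (simp add: has_derivative_imp_bc_dbar sum.distrib sum_distrib_left
        flip: scaleR_sum_right)
  also have "\<dots> = (\<Sum>k\<in>K. bc_dbar (f k) z)"
    by (intro sum.cong refl) (simp add: f'[THEN has_derivative_imp_bc_dbar])
  finally show ?thesis .
qed

lemma bc_dbar_scaleR:
  assumes "f differentiable at z"
  shows "bc_dbar (\<lambda>z. c *\<^sub>R f z) z = c *\<^sub>R bc_dbar f z"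
proof -
  obtain f' where f': "(f has_derivative f') (at z)"
    using assms by (auto simp: differentiable_def)
  show ?thesis
    using has_derivative_imp_bc_dbar[OF has_derivative_scaleR_right[OF f', of c]]
    by (simp add: has_derivative_imp_bc_dbar[OF f'] scaleR_add_right)
qed

lemma has_derivative_bc_hat_cnj:
  "((\<lambda>z. bc_hat (cnj z)) has_derivative (\<lambda>h. bc_hat (cnj h))) (at z)"
proof -
  have "bounded_linear (\<lambda>h. bc_hat (cnj h))"
  proof (rule bounded_linear_intro[where K = 1])
    show "norm (bc_hat (cnj h)) \<le> norm h * 1" for h
      using norm_bc_hat_mult[of "cnj h" 1]
      by (simp add: norm_bicomplex_def[of 1] bc_plus_def bc_minus_def)
  qed (simp_all add: bc_hat_def algebra_simps scaleR_conv_of_real)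
  then show ?thesis
    by (rule bounded_linear_imp_has_derivative)
qed

lemma bc_dbar_bc_hat_cnj: "bc_dbar (\<lambda>z. bc_hat (cnj z)) z = 1"
  unfolding has_derivative_imp_bc_dbar[OF has_derivative_bc_hat_cnj]
  by (simp add: bicomplex_eq_iff bc_hat_def bc_j_def of_real_def complex_eq_iff)

lemma
  shows differentiable_bc_hat_cnj_power: "(\<lambda>z. bc_hat (cnj z) ^ k) differentiable at z"
    and bc_dbar_bc_hat_cnj_power:
      "bc_dbar (\<lambda>z. bc_hat (cnj z) ^ k) z = real k *\<^sub>R bc_hat (cnj z) ^ (k - 1)"
proof -
  have hat: "(\<lambda>z. bc_hat (cnj z)) differentiable at z"
    using has_derivative_bc_hat_cnj by (auto simp: differentiable_def)
  have "(\<lambda>z. bc_hat (cnj z) ^ k) differentiable at z \<and>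
    bc_dbar (\<lambda>z. bc_hat (cnj z) ^ k) z = real k *\<^sub>R bc_hat (cnj z) ^ (k - 1)"
  proof (induction k)
    case 0
    show ?case
      using has_derivative_imp_bc_dbar[OF has_derivative_const, of 1 z] by simp
  next
    case (Suc k)
    moreover have "bc_hat (cnj z) * (real k *\<^sub>R bc_hat (cnj z) ^ (k - 1))
        = real k *\<^sub>R bc_hat (cnj z) ^ k"
      by (cases k) simp_all
    ultimately show ?case
      by (auto intro: differentiable_bicomplex_mult hat
        simp: bc_dbar_mult hat bc_dbar_bc_hat_cnj scaleR_add_left)
  qed
  then show "(\<lambda>z. bc_hat (cnj z) ^ k) differentiable at z"
    and "bc_dbar (\<lambda>z. bc_hat (cnj z) ^ k) z = real k *\<^sub>R bc_hat (cnj z) ^ (k - 1)"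
    by auto
qed

lemma differentiable_on_unit_disk_iff:
  "f differentiable_on unit_disk \<longleftrightarrow> (\<forall>z\<in>unit_disk. f differentiable at z)"
  by (rule differentiable_on_eq_differentiable_at) simp

lemma bc_hol_scaleR: "\<phi> \<in> bc_hol \<Longrightarrow> (\<lambda>z. c *\<^sub>R \<phi> z) \<in> bc_hol"
  by (auto simp: bc_hol_def differentiable_on_unit_disk_iff bc_dbar_scaleR
      intro: differentiable_scaleR)

text \<open>
  In each product $\zeta^k \varphi_k$ the derivation only sees the factor $\zeta^k$, because
  $\bar\partial\varphi_k = 0$; the term $k = 0$ disappears and the others shift down by one.
\<close>

lemma
  assumes "\<And>k. k < Suc n \<Longrightarrow> \<phi> k \<in> bc_hol"
    and "\<And>z. z \<in> unit_disk \<Longrightarrow> f z = (\<Sum>k<Suc n. bc_hat (cnj z) ^ k * \<phi> k z)"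
    and z: "z \<in> unit_disk"
  shows differentiable_polyanalytic_sum: "f differentiable at z"
    and bc_dbar_polyanalytic_sum:
      "bc_dbar f z = (\<Sum>k<n. bc_hat (cnj z) ^ k * (real (Suc k) *\<^sub>R \<phi> (Suc k) z))"
proof -
  let ?s = "\<lambda>z. \<Sum>k<Suc n. bc_hat (cnj z) ^ k * \<phi> k z"
  have \<phi>: "\<phi> k differentiable at z" "bc_dbar (\<phi> k) z = 0" if "k < Suc n" for k
    using assms(1)[OF that] z by (auto simp: bc_hol_def differentiable_on_unit_disk_iff)
  have summand: "(\<lambda>z. bc_hat (cnj z) ^ k * \<phi> k z) differentiable at z" if "k < Suc n" for k
    using that by (intro differentiable_bicomplex_mult differentiable_bc_hat_cnj_power \<phi>)
  have s: "?s differentiable at z"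
    by (intro differentiable_sum) (auto intro: summand)
  have fs: "?s w = f w" if "w \<in> unit_disk" for w
    using assms(2)[OF that] by simp
  obtain s' where "(?s has_derivative s') (at z)"
    using s unfolding differentiable_def ..
  then have "(f has_derivative s') (at z)"
    by (rule has_derivative_transform_within_open[OF _ open_ball z fs])
  then show "f differentiable at z"
    unfolding differentiable_def by blast
  have "bc_dbar f z = bc_dbar ?s z"
    by (rule bc_dbar_cong_open[OF open_ball z s fs])
  also have "\<dots> = (\<Sum>k<Suc n. bc_dbar (\<lambda>z. bc_hat (cnj z) ^ k * \<phi> k z) z)"
    by (rule bc_dbar_sum) (simp add: summand)
  also have "\<dots> = (\<Sum>k<Suc n. (real k *\<^sub>R bc_hat (cnj z) ^ (k - 1)) * \<phi> k z)"
    by (intro sum.cong refl)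
      (simp add: bc_dbar_mult differentiable_bc_hat_cnj_power \<phi> bc_dbar_bc_hat_cnj_power)
  also have "\<dots> = (\<Sum>k<n. bc_hat (cnj z) ^ k * (real (Suc k) *\<^sub>R \<phi> (Suc k) z))"
    by (subst sum.lessThan_Suc_shift) simp
  finally show "bc_dbar f z = \<dots>" .
qed

section \<open>Functions of finite Hardy norm\<close>

definition circle_integral :: "real \<Rightarrow> (complex \<Rightarrow> bicomplex) \<Rightarrow> real \<Rightarrow> ennreal" where
  "circle_integral p f r =
    (\<integral>\<^sup>+\<theta>\<in>{0..2*pi}. ennreal (norm (f (of_real r * exp (\<i> * of_real \<theta>))) powr p) \<partial>lborel)"

text \<open>
  The outer exponent $1/p$ only rescales a bound, so finiteness of the norm can be tested on the
  integrals themselves, which are additive.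
\<close>

lemma hardy_norm_finite_iff:
  assumes "0 < p"
  shows "hardy_norm p f < \<infinity> \<longleftrightarrow> (\<exists>C. \<forall>r\<in>{0<..<1}. circle_integral p f r \<le> ennreal C)"
proof
  assume "hardy_norm p f < \<infinity>"
  then obtain M where M: "hardy_norm p f = ennreal M" "0 \<le> M"
    by (cases "hardy_norm p f") auto
  have "circle_integral p f r \<le> ennreal (M powr p)" if "r \<in> {0<..<1}" for r
  proof -
    have "ennreal_powr (circle_integral p f r) (1 / p) \<le> ennreal M"
      unfolding M(1)[symmetric] hardy_norm_def circle_integral_def
      using that by (intro SUP_upper)
    then show ?thesis
    proof (cases "circle_integral p f r")
      case (real x)
      with \<open>ennreal_powr _ _ \<le> _\<close> M have "x powr (1 / p) \<le> M"
        by (simp add: ennreal_powr_def)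
      then have "(x powr (1 / p)) powr p \<le> M powr p"
        using assms by (intro powr_mono2) auto
      then show ?thesis
        using assms real by (simp add: powr_powr ennreal_leI)
    qed (simp add: ennreal_powr_def top_unique)
  qed
  then show "\<exists>C. \<forall>r\<in>{0<..<1}. circle_integral p f r \<le> ennreal C"
    by blast
next
  assume "\<exists>C. \<forall>r\<in>{0<..<1}. circle_integral p f r \<le> ennreal C"
  then obtain C where C: "circle_integral p f r \<le> ennreal C" if "r \<in> {0<..<1}" for r
    by blast
  have "hardy_norm p f \<le> ennreal (max 0 C powr (1 / p))"
    unfolding hardy_norm_def circle_integral_def[symmetric]
  proof (rule SUP_least)
    fix r :: real assume r: "r \<in> {0<..<1}"
    then have "circle_integral p f r \<noteq> top"
      using C[OF r] by (auto simp: top_unique)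
    moreover have "enn2real (circle_integral p f r) \<le> max 0 C"
      using C[OF r] by (intro enn2real_leI) (auto simp: ennreal_max_0)
    ultimately show "ennreal_powr (circle_integral p f r) (1 / p)
        \<le> ennreal (max 0 C powr (1 / p))"
      using assms by (auto simp: ennreal_powr_def intro!: ennreal_leI powr_mono2)
  qed
  then show "hardy_norm p f < \<infinity>"
    by (rule order_le_less_trans) simp
qed

lemma circle_in_unit_disk:
  "r \<in> {0<..<1} \<Longrightarrow> complex_of_real r * exp (\<i> * of_real \<theta>) \<in> unit_disk"
  by (simp add: norm_mult)

text \<open>
  Continuity is built in because additivity of the integrals needs measurability of the integrands.
\<close>

definition hardy_fin :: "real \<Rightarrow> (complex \<Rightarrow> bicomplex) set" where
  "hardy_fin p = {f. continuous_on unit_disk f \<and> hardy_norm p f < \<infinity>}"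

lemma hardy_fin_iff_bounded:
  "0 < p \<Longrightarrow> f \<in> hardy_fin p \<longleftrightarrow>
    continuous_on unit_disk f \<and> (\<exists>C. \<forall>r\<in>{0<..<1}. circle_integral p f r \<le> ennreal C)"
  unfolding hardy_fin_def using hardy_norm_finite_iff by blast

lemma circle_integral_mono:
  assumes "0 < p" "0 \<le> c" "r \<in> {0<..<1}"
    and "continuous_on unit_disk g"
    and "\<And>z. z \<in> unit_disk \<Longrightarrow> norm (f z) \<le> c * norm (g z)"
  shows "circle_integral p f r \<le> ennreal (c powr p) * circle_integral p g r"
proof -
  have [measurable]: "(\<lambda>\<theta>. g (of_real r * exp (\<i> * of_real \<theta>))) \<in> borel_measurable lborel"
    using circle_in_unit_disk[OF assms(3)]
    by (auto intro!: borel_measurable_continuous_onI continuous_on_compose2[OF assms(4)]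
        continuous_intros)
  have "circle_integral p f r \<le> (\<integral>\<^sup>+\<theta>\<in>{0..2*pi}. ennreal (c powr p) *
      ennreal (norm (g (of_real r * exp (\<i> * of_real \<theta>))) powr p) \<partial>lborel)"
    unfolding circle_integral_def
  proof (intro nn_integral_mono mult_right_mono)
    fix \<theta> :: real
    let ?z = "complex_of_real r * exp (\<i> * of_real \<theta>)"
    have "norm (f ?z) powr p \<le> (c * norm (g ?z)) powr p"
      using assms(1,5) circle_in_unit_disk[OF assms(3)] by (intro powr_mono2) auto
    then show "ennreal (norm (f ?z) powr p)
        \<le> ennreal (c powr p) * ennreal (norm (g ?z) powr p)"
      using assms(2) by (simp add: powr_mult ennreal_leI flip: ennreal_mult)
  qed simp
  also have "\<dots> = ennreal (c powr p) * circle_integral p g r"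
    unfolding circle_integral_def mult.assoc by (rule nn_integral_cmult) measurable
  finally show ?thesis .
qed

lemma hardy_fin_dominated:
  assumes "0 < p" "0 \<le> c" "g \<in> hardy_fin p" "continuous_on unit_disk f"
    and "\<And>z. z \<in> unit_disk \<Longrightarrow> norm (f z) \<le> c * norm (g z)"
  shows "f \<in> hardy_fin p"
proof -
  obtain C where C: "circle_integral p g r \<le> ennreal C" if "r \<in> {0<..<1}" for r
    using assms(1,3) unfolding hardy_fin_iff_bounded[OF assms(1)] by blast
  have "circle_integral p f r \<le> ennreal (c powr p * C)" if r: "r \<in> {0<..<1}" for r
  proof -
    have "circle_integral p f r \<le> ennreal (c powr p) * circle_integral p g r"
      using assms r by (intro circle_integral_mono) (auto simp: hardy_fin_def)
    also have "\<dots> \<le> ennreal (c powr p) * ennreal C"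
      by (intro mult_left_mono C r) simp
    finally show ?thesis
      by (simp add: ennreal_mult')
  qed
  with assms(4) show ?thesis
    unfolding hardy_fin_iff_bounded[OF assms(1)] by blast
qed

text \<open>
  For $p < 1$ the triangle inequality fails; what holds for every $p > 0$ is
  $(a+b)^p \<le> (2\max(a,b))^p \<le> 2^p (a^p + b^p)$.
\<close>

lemma powr_add_le:
  fixes a b p :: real
  assumes "0 < p" "0 \<le> a" "0 \<le> b"
  shows "(a + b) powr p \<le> 2 powr p * (a powr p + b powr p)"
proof -
  have "(a + b) powr p \<le> (2 * max a b) powr p"
    using assms by (intro powr_mono2) auto
  also have "\<dots> = 2 powr p * max a b powr p"
    using assms by (simp add: powr_mult)
  also have "\<dots> \<le> 2 powr p * (a powr p + b powr p)"
    by (intro mult_left_mono) (auto simp: max_def)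
  finally show ?thesis .
qed

lemma hardy_fin_add:
  assumes "0 < p" "f \<in> hardy_fin p" "g \<in> hardy_fin p"
  shows "(\<lambda>z. f z + g z) \<in> hardy_fin p"
proof -
  have cont: "continuous_on unit_disk f" "continuous_on unit_disk g"
    using assms by (auto simp: hardy_fin_def)
  obtain C D where CD: "circle_integral p f r \<le> ennreal C" "circle_integral p g r \<le> ennreal D"
    if "r \<in> {0<..<1}" for r
    using assms(2,3) unfolding hardy_fin_iff_bounded[OF assms(1)] by metis
  have "circle_integral p (\<lambda>z. f z + g z) r \<le> ennreal (2 powr p * (max 0 C + max 0 D))"
    if r: "r \<in> {0<..<1}" for r
  proof -
    define F where "F = (\<lambda>\<theta>. f (complex_of_real r * exp (\<i> * of_real \<theta>)))"
    define G where "G = (\<lambda>\<theta>. g (complex_of_real r * exp (\<i> * of_real \<theta>)))"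
    have [measurable]: "F \<in> borel_measurable lborel" "G \<in> borel_measurable lborel"
      unfolding F_def G_def using circle_in_unit_disk[OF r]
      by (auto intro!: borel_measurable_continuous_onI continuous_on_compose2[OF cont(1)]
          continuous_on_compose2[OF cont(2)] continuous_intros)
    have "norm (F \<theta> + G \<theta>) powr p \<le> 2 powr p * (norm (F \<theta>) powr p + norm (G \<theta>) powr p)" for \<theta>
      using assms(1)
      by (intro order_trans[OF powr_mono2[OF _ _ norm_triangle_ineq] powr_add_le]) auto
    then have "circle_integral p (\<lambda>z. f z + g z) r \<le> (\<integral>\<^sup>+\<theta>. ennreal (2 powr p) *
        (ennreal (norm (F \<theta>) powr p) * indicator {0..2*pi} \<theta>
          + ennreal (norm (G \<theta>) powr p) * indicator {0..2*pi} \<theta>) \<partial>lborel)"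
      unfolding circle_integral_def F_def[symmetric] G_def[symmetric]
      by (intro nn_integral_mono)
        (auto simp: F_def G_def indicator_def ennreal_leI
          simp flip: ennreal_mult ennreal_plus)
    also have "\<dots> = ennreal (2 powr p) * (circle_integral p f r + circle_integral p g r)"
      by (simp add: circle_integral_def nn_integral_cmult nn_integral_add
          flip: fun_cong[OF F_def] fun_cong[OF G_def])
    also have "\<dots> \<le> ennreal (2 powr p) * (ennreal (max 0 C) + ennreal (max 0 D))"
      using CD[OF r] by (intro mult_left_mono add_mono) (auto simp: ennreal_max_0)
    finally show ?thesis
      by (simp add: ennreal_mult')
  qed
  then show ?thesis
    unfolding hardy_fin_iff_bounded[OF assms(1)] using continuous_on_add[OF cont] by blast
qed

lemma hardy_fin_scaleR:
  assumes "0 < p" "f \<in> hardy_fin p"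
  shows "(\<lambda>z. c *\<^sub>R f z) \<in> hardy_fin p"
  by (rule hardy_fin_dominated[where c = "\<bar>c\<bar>", OF assms(1) _ assms(2)])
    (use assms(2) in \<open>auto simp: hardy_fin_def intro!: continuous_intros\<close>)

lemma hardy_fin_sum:
  assumes "0 < p" "\<And>k. k \<in> K \<Longrightarrow> f k \<in> hardy_fin p"
  shows "(\<lambda>z. \<Sum>k\<in>K. f k z) \<in> hardy_fin p"
proof -
  have "(\<lambda>z :: complex. 0) \<in> hardy_fin p"
    using assms(1) by (auto simp: hardy_fin_iff_bounded circle_integral_def)
  with assms(2) show ?thesis
    by (induction K rule: infinite_finite_induct) (auto intro: hardy_fin_add[OF assms(1)])
qed

lemma hardy_fin_bc_hat_cnj_power_mult:
  assumes "0 < p" "f \<in> hardy_fin p"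
  shows "(\<lambda>z. bc_hat (cnj z) ^ k * f z) \<in> hardy_fin p"
proof (rule hardy_fin_dominated[OF assms(1) _ assms(2), of 1])
  have "isCont (\<lambda>z. bc_hat (cnj z) ^ k) z" for z
    by (rule differentiable_imp_continuous_within[OF differentiable_bc_hat_cnj_power])
  then have "continuous_on unit_disk (\<lambda>z. bc_hat (cnj z) ^ k)"
    by (simp add: continuous_at_imp_continuous_on)
  then show "continuous_on unit_disk (\<lambda>z. bc_hat (cnj z) ^ k * f z)"
    using assms(2)
    by (auto simp: hardy_fin_def
        intro: bounded_bilinear.continuous_on[OF bounded_bilinear_bicomplex_mult])
  show "norm (bc_hat (cnj z) ^ k * f z) \<le> 1 * norm (f z)" if "z \<in> unit_disk" for z
    using that
    by (auto simp: norm_bc_hat_power_mult intro!: mult_left_le_one_le power_le_one)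
qed simp

lemma hardy_fin_iff:
  "f differentiable_on unit_disk \<Longrightarrow> f \<in> hardy_fin p \<longleftrightarrow> hardy_norm p f < \<infinity>"
  by (simp add: hardy_fin_def differentiable_imp_continuous_on)

lemma bc_hardy_iff: "\<phi> \<in> bc_hol \<Longrightarrow> \<phi> \<in> bc_hardy p \<longleftrightarrow> \<phi> \<in> hardy_fin p"
  by (auto simp: bc_hardy_def bc_hol_def hardy_fin_iff)

lemma hardy_fin_scaleR_iff:
  assumes "0 < p" "c \<noteq> 0"
  shows "(\<lambda>z. c *\<^sub>R f z) \<in> hardy_fin p \<longleftrightarrow> f \<in> hardy_fin p"
proof
  assume "(\<lambda>z. c *\<^sub>R f z) \<in> hardy_fin p"
  then have "(\<lambda>z. inverse c *\<^sub>R c *\<^sub>R f z) \<in> hardy_fin p"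
    by (rule hardy_fin_scaleR[OF assms(1)])
  then show "f \<in> hardy_fin p"
    using assms(2) by simp
qed (rule hardy_fin_scaleR[OF assms(1)])

lemma hardy_fin_add_cancel:
  assumes "0 < p" "g \<in> hardy_fin p" "continuous_on unit_disk f"
    and eq: "\<And>z. z \<in> unit_disk \<Longrightarrow> f z = h z + g z"
    and "continuous_on unit_disk h"
  shows "f \<in> hardy_fin p \<longleftrightarrow> h \<in> hardy_fin p"
proof
  assume "h \<in> hardy_fin p"
  then have "(\<lambda>z. h z + g z) \<in> hardy_fin p"
    using assms(1,2) by (intro hardy_fin_add)
  then show "f \<in> hardy_fin p"
    by (rule hardy_fin_dominated[where c = 1, OF assms(1) _ _ assms(3), rotated])
      (simp_all add: eq)
next
  assume "f \<in> hardy_fin p"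
  then have "(\<lambda>z. f z + (- 1) *\<^sub>R g z) \<in> hardy_fin p"
    using assms(1,2) by (intro hardy_fin_add hardy_fin_scaleR)
  then show "h \<in> hardy_fin p"
    by (rule hardy_fin_dominated[where c = 1, OF assms(1) _ _ assms(5), rotated])
      (simp_all add: eq)
qed

section \<open>Polyanalytic Hardy functions\<close>

lemma bc_poly_hardy_Suc:
  "f \<in> bc_poly_hardy (Suc n) p \<longleftrightarrow>
    f differentiable_on unit_disk \<and> hardy_norm p f < \<infinity> \<and> bc_dbar f \<in> bc_poly_hardy n p"
proof -
  have iter: "(bc_dbar ^^ Suc k) f = (bc_dbar ^^ k) (bc_dbar f)" for k
    by (simp only: funpow_Suc_right comp_apply)
  show ?thesis
    unfolding bc_poly_hardy_def bc_poly_def mem_Collect_eq All_less_Suc2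
      sum.lessThan_Suc_shift iter funpow_0
    by (auto simp: less_top)
qed

text \<open>
  The induction starts at the empty sum, where both sides hold trivially: the Hardy norm of
  $\varphi_0$ is recovered only after those of the higher coefficients are known to be finite.
\<close>

lemma bc_poly_hardy_iff_coeffs:
  assumes "0 < p"
    and "\<And>k. k < n \<Longrightarrow> \<phi> k \<in> bc_hol"
    and "\<And>z. z \<in> unit_disk \<Longrightarrow> f z = (\<Sum>k<n. bc_hat (cnj z) ^ k * \<phi> k z)"
  shows "f \<in> bc_poly_hardy n p \<longleftrightarrow> (\<forall>k<n. \<phi> k \<in> bc_hardy p)"
  using assms(2,3)
proof (induction n arbitrary: f \<phi>)
  case 0
  then show ?case
    by (simp add: bc_poly_hardy_def bc_poly_def)
next
  case (Suc n)
  let ?\<psi> = "\<lambda>k z. real (Suc k) *\<^sub>R \<phi> (Suc k) z"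
  let ?g = "\<lambda>z. \<Sum>k<n. bc_hat (cnj z) ^ Suc k * \<phi> (Suc k) z"
  have f_diff: "f differentiable_on unit_disk"
    using differentiable_polyanalytic_sum[OF Suc.prems]
    by (simp add: differentiable_on_unit_disk_iff)
  have \<psi>: "?\<psi> k \<in> bc_hol" if "k < n" for k
    using that by (intro bc_hol_scaleR Suc.prems) simp
  have "bc_dbar f \<in> bc_poly_hardy n p \<longleftrightarrow> (\<forall>k<n. ?\<psi> k \<in> bc_hardy p)"
    using bc_dbar_polyanalytic_sum[OF Suc.prems] \<psi> by (intro Suc.IH)
  also have "\<dots> \<longleftrightarrow> (\<forall>k<n. \<phi> (Suc k) \<in> hardy_fin p)"
    using \<psi> hardy_fin_scaleR_iff[OF assms(1)]
    by (auto simp: bc_hardy_iff simp del: of_nat_Suc)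
  finally have higher: "bc_dbar f \<in> bc_poly_hardy n p \<longleftrightarrow> (\<forall>k<n. \<phi> (Suc k) \<in> hardy_fin p)" .
  have lowest: "f \<in> hardy_fin p \<longleftrightarrow> \<phi> 0 \<in> hardy_fin p" if "\<forall>k<n. \<phi> (Suc k) \<in> hardy_fin p"
  proof (rule hardy_fin_add_cancel[OF assms(1)])
    show "?g \<in> hardy_fin p"
      using that by (intro hardy_fin_sum hardy_fin_bc_hat_cnj_power_mult assms(1)) auto
    show "continuous_on unit_disk f" "continuous_on unit_disk (\<phi> 0)"
      using f_diff Suc.prems(1)[of 0]
      by (auto simp: bc_hol_def differentiable_imp_continuous_on)
    show "f z = \<phi> 0 z + ?g z" if "z \<in> unit_disk" for z
      using Suc.prems(2)[OF that] by (subst (asm) sum.lessThan_Suc_shift) simp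
  qed
  have "f \<in> bc_poly_hardy (Suc n) p \<longleftrightarrow> f \<in> hardy_fin p \<and> bc_dbar f \<in> bc_poly_hardy n p"
    by (simp add: bc_poly_hardy_Suc f_diff hardy_fin_iff)
  also have "\<dots> \<longleftrightarrow> \<phi> 0 \<in> hardy_fin p \<and> (\<forall>k<n. \<phi> (Suc k) \<in> hardy_fin p)"
    using higher lowest by blast
  also have "\<dots> \<longleftrightarrow> (\<forall>k<Suc n. \<phi> k \<in> bc_hardy p)"
    using Suc.prems(1) by (auto simp: All_less_Suc2 bc_hardy_iff)
  finally show ?case .
qed

theorem theorem5p4:
  fixes p :: real and n :: nat
    and f :: "complex \<Rightarrow> bicomplex" and \<phi> :: "nat \<Rightarrow> complex \<Rightarrow> bicomplex"
  assumes "0 < p" and "0 < n"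
    and "\<And>k. k < n \<Longrightarrow> \<phi> k \<in> bc_hol"
    and "\<And>z. z \<in> unit_disk \<Longrightarrow> f z = (\<Sum>k<n. bc_hat (cnj z) ^ k * \<phi> k z)"
  shows "f \<in> bc_poly_hardy n p \<longleftrightarrow> (\<forall>k<n. \<phi> k \<in> bc_hardy p)"
  using assms(1,3,4) by (rule bc_poly_hardy_iff_coeffs)

end
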